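(* Let $n\ge1$ and let $\psi:[0,\infty)\to[0,\infty)$ be any measurable function such that $\psi(0)=0$ and $\lim_{t\to\infty}\psi(t)=+\infty$. Then there is a finite constant $c_{n,\psi}>0$, depending only on $n$ and $\psi$, such that for every measurable $f:\mathbb{R}^n\to\mathbb{R}$, $$\|f\|_{\mathrm{BMO}}\le c_{n,\psi}\,\|f\|_{\mathrm{BMO}_\psi}.$$
   Context: All cubes $Q\subset\mathbb{R}^n$ have sides parallel to the coordinate axes; $|Q|$ is Lebesgue measure and $f_Q=\frac1{|Q|}\int_Q f\,dx$. Define $$\|f\|_{\mathrm{BMO}}=\sup_Q \frac1{|Q|}\int_Q|f-f_Q|\,dx,$$ the supremum being over all cubes $Q$ (with $\|f\|_{\mathrm{BMO}}=\infty$ if $f$ is not locally integrable). For a cube $Q$ and a measurable function $g$ set $$\|g\|_{\psi,Q}=\inf\Big\{\lambda>0:\ \frac1{|Q|}\int_Q\psi\Big(\frac{|g|}{\lambda}\Big)dx\le 1\Big\}$$ (with $\inf\emptyset=\infty$), and define $$\|f\|_{\mathrm{BMO}_\psi}=\sup_Q\inf_{c\in\mathbb{R}}\|f-c\|_{\psi,Q},$$ the supremum being over all cubes. No local integrability of $f$ is assumed a priori in the definition of $\|f\|_{\mathrm{BMO}_\psi}$. *)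

theory Defs
  imports "HOL-Analysis.Analysis"
begin

definition cubes :: "(real ^ 'n::finite) set set" where
  "cubes = {cbox a (\<chi> i. a $ i + l) | a l. l > 0}"

definition locally_integrable :: "(real ^ 'n::finite \<Rightarrow> real) \<Rightarrow> bool" where
  "locally_integrable f \<longleftrightarrow> (\<forall>K. compact K \<longrightarrow> set_integrable lebesgue K f)"

definition average :: "(real ^ 'n::finite) set \<Rightarrow> (real ^ 'n \<Rightarrow> real) \<Rightarrow> real" where
  "average Q f = (LINT x:Q|lebesgue. f x) / measure lebesgue Q"

definition bmo_norm :: "(real ^ 'n::finite \<Rightarrow> real) \<Rightarrow> ennreal" where
  "bmo_norm f =
     (if locally_integrable f
      then SUP Q\<in>cubes. ennreal (average Q (\<lambda>x. \<bar>f x - average Q f\<bar>))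
      else \<infinity>)"

text \<open>
  The function \<open>\<psi>\<close> is only ever evaluated on \<open>[0, \<infinity>)\<close>. The average of \<open>\<psi> (\<bar>g\<bar> / \<lambda>)\<close> may be
  infinite, hence the nonnegative integral. If \<open>\<psi>\<close> is Lebesgue but not Borel measurable, the
  composition can fail to be measurable; the nonnegative integral is then the lower integral.
  The infimum is taken in \<^typ>\<open>ennreal\<close>, where the infimum of the empty set is \<open>\<infinity>\<close>.
\<close>

definition psi_norm ::
    "(real \<Rightarrow> real) \<Rightarrow> (real ^ 'n::finite) set \<Rightarrow> (real ^ 'n \<Rightarrow> real) \<Rightarrow> ennreal" where
  "psi_norm \<psi> Q g =
     Inf {ennreal l | l. l > 0 \<and>
       (\<integral>\<^sup>+x\<in>Q. ennreal (\<psi> (\<bar>g x\<bar> / l)) \<partial>lebesgue) / emeasure lebesgue Q \<le> 1}"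

definition bmo_psi_norm :: "(real \<Rightarrow> real) \<Rightarrow> (real ^ 'n::finite \<Rightarrow> real) \<Rightarrow> ennreal" where
  "bmo_psi_norm \<psi> f = (SUP Q\<in>cubes. INF c::real. psi_norm \<psi> Q (\<lambda>x. f x - c))"

end

theory Submission
  imports Defs
begin

text \<open>
  If \<open>\<psi> \<ge> N\<close> on \<open>[T, \<infinity>)\<close> and the \<open>BMO\<^sub>\<psi>\<close> norm of \<open>f\<close> is below \<open>A\<close>, then by Chebyshev every cube \<open>Q\<close> carries a
  constant \<open>c\<^sub>Q\<close> with \<open>|{x \<in> Q: |f - c\<^sub>Q| > B}| \<le> |Q| / N\<close>, where \<open>B = T A\<close>. With \<open>N = 8 \<cdot> 2\<^sup>n\<close>, the maximal
  dyadic subcubes \<open>K\<close> of \<open>Q\<close> in which the exceptional set has density above \<open>1 / (4 \<cdot> 2\<^sup>n)\<close> fill at most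
  half of \<open>Q\<close>, satisfy \<open>|c\<^sub>K - c\<^sub>Q| \<le> 2 B\<close>, and cover the exceptional set up to a null set. Hence if
  \<open>s\<close> bounds the average of \<open>min |f - c\<^sub>Q| M\<close> over every cube, so does \<open>B + (s + 2 B) / 2\<close>. Starting from
  \<open>s = M\<close>, iteration yields the bound \<open>4 B\<close>, uniformly in \<open>M\<close>, and the truncation can be removed.
  Half-open cubes make the dyadic cells exact partitions.
\<close>

declare emeasure_completion [simp del]

section \<open>Half-open cubes and their agreement with closed cubes up to null sets\<close>

definition hcube :: "real ^ 'n::finite \<Rightarrow> real \<Rightarrow> (real ^ 'n) set" where
  "hcube a l = {x. \<forall>i. a $ i \<le> x $ i \<and> x $ i < a $ i + l}"

lemma hcube_cbox_symdiff:
  "negligible (sym_diff (cbox a (\<chi> i. a $ i + l)) (hcube a l))"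
proof (rule negligible_subset[OF negligible_frontier_interval])
  show "sym_diff (cbox a (\<chi> i. a $ i + l)) (hcube a l)
      \<subseteq> cbox a (\<chi> i. a $ i + l) - box a (\<chi> i. a $ i + l)"
    by (force simp: hcube_def mem_box_cart intro: less_imp_le)
qed

lemma lmeasurable_hcube [simp, intro]: "hcube a l \<in> lmeasurable"
  using lmeasurable_negligible_symdiff[OF lmeasurable_cbox hcube_cbox_symdiff] .

lemma sets_hcube [simp, intro, measurable]: "hcube a l \<in> sets lebesgue"
  using lmeasurable_hcube by blast

lemma emeasure_cube:
  assumes "l > 0"
  shows "emeasure lebesgue (cbox (a :: real ^ 'n::finite) (\<chi> i. a $ i + l)) = ennreal (l ^ CARD('n))"
proof -
  have "cbox a (\<chi> i. a $ i + l) \<noteq> {}"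
    using assms by (auto simp: interval_ne_empty_cart)
  then have "measure lebesgue (cbox a (\<chi> i. a $ i + l)) = l ^ CARD('n)"
    by (simp add: content_cbox_cart)
  then show ?thesis
    by (metis emeasure_eq_measure2 lmeasurable_cbox)
qed

lemma emeasure_hcube:
  assumes "l > 0"
  shows "emeasure lebesgue (hcube (a :: real ^ 'n::finite) l) = ennreal (l ^ CARD('n))"
proof -
  have "measure lebesgue (hcube a l) = measure lebesgue (cbox a (\<chi> i. a $ i + l))"
    by (rule measure_negligible_symdiff[OF _ hcube_cbox_symdiff]) simp
  then show ?thesis
    using emeasure_cube[OF assms, of a]
    by (metis emeasure_eq_measure2 lmeasurable_cbox lmeasurable_hcube)
qed

lemma AE_hcube_cbox:
  "AE x in lebesgue. x \<in> hcube a l \<longleftrightarrow> x \<in> cbox a (\<chi> i. a $ i + l)"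
proof -
  have "sym_diff (cbox a (\<chi> i. a $ i + l)) (hcube a l) \<in> null_sets lebesgue"
    using hcube_cbox_symdiff by (simp add: negligible_iff_null_sets)
  from AE_not_in[OF this] show ?thesis
    by eventually_elim auto
qed

section \<open>The dyadic grid generated by a cube\<close>

text \<open>This is the grid cube of side \<open>l / 2 ^ m\<close> that contains \<open>x\<close>,
  for the grid anchored at \<open>a\<close>. The grid fills the whole space, and naming cells by
  their points instead of integer vectors lets selections be made pointwise.\<close>

definition cell :: "real ^ 'n::finite \<Rightarrow> real \<Rightarrow> nat \<Rightarrow> real ^ 'n \<Rightarrow> (real ^ 'n) set" where
  "cell a l m x =
    hcube (\<chi> i. a $ i + l / 2 ^ m * real_of_int \<lfloor>(x $ i - a $ i) / (l / 2 ^ m)\<rfloor>) (l / 2 ^ m)"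

text \<open>Each generation becomes an equivalence relation: two points share a cell when their
  integer index vectors agree. Partition and nesting properties then reduce to arithmetic of
  floors.\<close>

lemma mem_cell_iff:
  assumes "l > 0"
  shows "y \<in> cell a l m x \<longleftrightarrow>
    (\<forall>i. \<lfloor>(y $ i - a $ i) / (l / 2 ^ m)\<rfloor> = \<lfloor>(x $ i - a $ i) / (l / 2 ^ m)\<rfloor>)"
proof -
  define s where "s = l / 2 ^ m"
  have s: "s > 0" using assms by (simp add: s_def)
  have "a $ i + s * real_of_int k \<le> y $ i \<and> y $ i < a $ i + s * real_of_int k + s \<longleftrightarrow>
      \<lfloor>(y $ i - a $ i) / s\<rfloor> = k" for i k
    using s by (auto simp: floor_eq_iff field_simps)
  then show ?thesis
    by (simp add: cell_def hcube_def s_def)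
qed

lemma self_mem_cell: "l > 0 \<Longrightarrow> x \<in> cell a l m x"
  by (simp add: mem_cell_iff)

lemma cell_eq:
  assumes "l > 0" "y \<in> cell a l m x"
  shows "cell a l m y = cell a l m x"
  using assms(2) unfolding mem_cell_iff[OF assms(1)] by (simp only: cell_def)

lemma cell_Suc_subset:
  assumes "l > 0"
  shows "cell a l (Suc m) x \<subseteq> cell a l m x"
proof -
  \<comment> \<open>The index at generation \<open>m\<close> is the index at generation
    \<open>Suc m\<close> halved and rounded down, so agreement at the finer generation forces
    agreement at the coarser one.\<close>
  have *: "\<lfloor>t / (l / 2 ^ m)\<rfloor> = \<lfloor>t / (l / 2 ^ Suc m)\<rfloor> div 2" for t :: real
    using floor_divide_real_eq_div[of 2 "t / (l / 2 ^ Suc m)"] by (simp add: field_simps)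
  show ?thesis
    by (simp only: subset_iff mem_cell_iff[OF assms] *) simp
qed

lemma cell_antimono:
  assumes "l > 0" "j \<le> m"
  shows "cell a l m x \<subseteq> cell a l j x"
  using assms(2) by (induction rule: dec_induct) (use cell_Suc_subset[OF assms(1)] in blast)+

lemma cell_0:
  assumes "l > 0" "x \<in> hcube a l"
  shows "cell a l 0 x = hcube a l"
proof -
  have "\<lfloor>(x $ i - a $ i) / l\<rfloor> = 0" for i
    using assms by (auto simp: hcube_def floor_eq_iff field_simps)
  then show ?thesis
    by (simp add: cell_def)
qed

lemma emeasure_cell:
  "l > 0 \<Longrightarrow> emeasure lebesgue (cell a l m (x :: real ^ 'n::finite)) = ennreal ((l / 2 ^ m) ^ CARD('n))"
  unfolding cell_def by (rule emeasure_hcube) simp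

text \<open>Although \<open>x\<close> ranges over an uncountable set, a cell depends only on
  \<open>m\<close> and on an integer vector.\<close>

lemma countable_cells: "countable {cell a l m (x :: real ^ 'n::finite) | m x. P m x}"
proof -
  have "{cell a l m x | m x. P m x} \<subseteq>
    (\<lambda>(m, k :: int ^ 'n). hcube (\<chi> i. a $ i + l / 2 ^ m * real_of_int (k $ i)) (l / 2 ^ m)) ` UNIV"
  proof clarify
    fix m x
    show "cell a l m x \<in> (\<lambda>(m, k :: int ^ 'n). hcube (\<chi> i. a $ i + l / 2 ^ m * real_of_int (k $ i)) (l / 2 ^ m)) ` UNIV"
      by (rule image_eqI[where x = "(m, \<chi> i. \<lfloor>(x $ i - a $ i) / (l / 2 ^ m)\<rfloor>)"]) (simp_all add: cell_def)
  qed
  then show ?thesis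
    by (rule countable_subset) simp
qed

lemma small_cell:
  assumes "l > 0" "open U" "x \<in> U"
  shows "\<exists>m. cell a l m (x :: real ^ 'n::finite) \<subseteq> U"
proof -
  obtain e where e: "e > 0" "ball x e \<subseteq> U"
    using assms openE by blast
  \<comment> \<open>Distances within a cell are estimated through the l1 norm, hence by the
    dimension times the side.\<close>
  have "(\<lambda>m. real CARD('n) * l * (1 / 2) ^ m) \<longlonglongrightarrow> real CARD('n) * l * 0"
    by (intro tendsto_intros LIMSEQ_realpow_zero) auto
  then have "eventually (\<lambda>m. real CARD('n) * l * (1 / 2) ^ m < e) sequentially"
    using e by (intro order_tendstoD) auto
  then obtain m where m: "real CARD('n) * (l / 2 ^ m) < e"
    by (auto simp: eventually_sequentially field_simps)
  have "dist x y < e" if "y \<in> cell a l m x" for y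
  proof -
    have "\<bar>(x - y) $ i\<bar> \<le> l / 2 ^ m" for i
      using that self_mem_cell[OF assms(1), of x a m]
      unfolding cell_def hcube_def by (simp add: abs_le_iff) (smt (verit))
    then have "(\<Sum>i\<in>UNIV. \<bar>(x - y) $ i\<bar>) \<le> real CARD('n) * (l / 2 ^ m)"
      using sum_bounded_above[of "UNIV :: 'n set" "\<lambda>i. \<bar>(x - y) $ i\<bar>" "l / 2 ^ m"] by simp
    with norm_le_l1_cart[of "x - y"] m show ?thesis
      by (simp add: dist_norm)
  qed
  then show ?thesis
    using e by (auto simp: subset_iff)
qed

lemma sets_cell [simp, measurable]: "cell a l m x \<in> sets lebesgue"
  unfolding cell_def by (rule sets_hcube)

section \<open>Stopping cells and their covering properties\<close>

text \<open>These are the stopping cells: descending through the cells around a point of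
  \<open>S\<close>, one stops at the first, hence largest, cell with \<open>P\<close>.\<close>

definition first_cells ::
    "real ^ 'n::finite \<Rightarrow> real \<Rightarrow> ((real ^ 'n) set \<Rightarrow> bool) \<Rightarrow> (real ^ 'n) set \<Rightarrow> (real ^ 'n) set set" where
  "first_cells a l P S =
    {cell a l m x | m x. x \<in> S \<and> P (cell a l m x) \<and> (\<forall>j<m. \<not> P (cell a l j x))}"

lemma countable_first_cells: "countable (first_cells a l P S)"
  unfolding first_cells_def by (rule countable_cells)

text \<open>A stopping cell can be recovered from any of its points \<open>z\<close>: the cells
  around \<open>z\<close> and around the selecting point coincide down to the stopping generation,
  so it is also the first cell with \<open>P\<close> around \<open>z\<close>. Two stopping cells
  with a common point are therefore equal.\<close>

lemma disjoint_first_cells: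
  assumes "l > 0"
  shows "disjoint (first_cells a l P S)"
proof (rule disjointI, rule ccontr)
  fix K L
  assume K: "K \<in> first_cells a l P S" and L: "L \<in> first_cells a l P S"
    and "K \<noteq> L" "K \<inter> L \<noteq> {}"
  have first: "K = cell a l (LEAST j. P (cell a l j z)) z"
    if K: "K \<in> first_cells a l P S" and "z \<in> K" for K z
  proof -
    obtain m x where m: "K = cell a l m x" "P (cell a l m x)" "\<forall>j<m. \<not> P (cell a l j x)"
      using K unfolding first_cells_def by blast
    have "cell a l j z = cell a l j x" if "j \<le> m" for j
      using cell_antimono[OF assms that, of a x] \<open>z \<in> K\<close> m(1) by (intro cell_eq assms) auto
    with m have "P (cell a l m z)" "\<And>j. P (cell a l j z) \<Longrightarrow> m \<le> j" "K = cell a l m z"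
      by (metis le_refl, metis not_le less_imp_le, metis le_refl)
    then show ?thesis
      by (metis (mono_tags, lifting) Least_equality)
  qed
  then show False
    using K L \<open>K \<noteq> L\<close> \<open>K \<inter> L \<noteq> {}\<close> by (metis disjoint_iff)
qed

lemma mem_Union_first_cells:
  assumes "l > 0" "x \<in> S" "P (cell a l m x)"
  shows "x \<in> \<Union> (first_cells a l P S)"
proof -
  define k where "k = (LEAST j. P (cell a l j x))"
  have "P (cell a l k x)" "\<forall>j<k. \<not> P (cell a l j x)"
    unfolding k_def using assms(3) by (auto intro: LeastI dest: not_less_Least)
  then have "cell a l k x \<in> first_cells a l P S"
    using assms(2) by (auto simp: first_cells_def)
  then show ?thesis
    using self_mem_cell[OF assms(1)] by blast
qed

lemma first_cells_hcube:
  assumes "l > 0" "K \<in> first_cells a l P S"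
  shows "\<exists>b r. r > 0 \<and> K = hcube b r"
proof -
  obtain m x where "K = cell a l m x"
    using assms(2) by (auto simp: first_cells_def)
  moreover have "l / 2 ^ m > 0"
    using assms(1) by simp
  ultimately show ?thesis
    unfolding cell_def by blast
qed

section \<open>Density of sets in cells and the Calderon-Zygmund selection\<close>

text \<open>An integral over the union is the measure of the union under a density, so countable
  additivity splits it into integrals over the pieces, which are compared one by one.\<close>

lemma nn_integral_Union_mono:
  assumes "countable \<K>" "disjoint \<K>" "\<K> \<subseteq> sets M"
    and [measurable]: "g \<in> borel_measurable M" "h \<in> borel_measurable M"
    and le: "\<And>K. K \<in> \<K> \<Longrightarrow> (\<integral>\<^sup>+x\<in>K. g x \<partial>M) \<le> (\<integral>\<^sup>+x\<in>K. h x \<partial>M)"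
  shows "(\<integral>\<^sup>+x\<in>\<Union>\<K>. g x \<partial>M) \<le> (\<integral>\<^sup>+x\<in>\<Union>\<K>. h x \<partial>M)"
proof -
  have *: "(\<integral>\<^sup>+x\<in>\<Union>\<K>. u x \<partial>M) = (\<integral>\<^sup>+K. (\<integral>\<^sup>+x\<in>K. u x \<partial>M) \<partial>count_space \<K>)"
    if [measurable]: "u \<in> borel_measurable M" for u
  proof -
    have U: "\<Union>\<K> \<in> sets M"
      using assms(1,3) by (intro sets.countable_Union) auto
    have "emeasure (density M u) (\<Union>K\<in>\<K>. K) = (\<integral>\<^sup>+K. emeasure (density M u) K \<partial>count_space \<K>)"
      using assms(1-3)
      by (intro emeasure_UN_countable) (auto simp: disjoint_family_on_def disjoint_def)
    also have "\<dots> = (\<integral>\<^sup>+K. (\<integral>\<^sup>+x\<in>K. u x \<partial>M) \<partial>count_space \<K>)"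
      using assms(3) by (intro nn_integral_cong) (auto simp: emeasure_density)
    finally show ?thesis
      using U by (simp add: emeasure_density)
  qed
  show ?thesis
    by (auto simp: * intro!: nn_integral_mono le)
qed

lemma first_cells_sets: "l > 0 \<Longrightarrow> first_cells a l P S \<subseteq> sets lebesgue"
  using first_cells_hcube by blast

text \<open>This takes the place of the Lebesgue density theorem. An open set \<open>U\<close>
  slightly larger than \<open>F\<close> contains disjoint cells covering \<open>F\<close>, each
  filled by \<open>F\<close> to a fraction at most \<alpha>; thus the measure of \<open>F\<close> is
  at most \<alpha> times that of \<open>U\<close>, and \<open>U\<close> can be taken arbitrarily
  close to \<open>F\<close>.\<close>

lemma null_if_sparse_in_cells:
  fixes F :: "(real ^ 'n::finite) set"
  assumes F: "F \<in> lmeasurable" and l: "l > 0" and \<alpha>: "0 \<le> \<alpha>" "\<alpha> < 1"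
    and sparse: "\<And>x m. x \<in> F \<Longrightarrow>
      emeasure lebesgue (F \<inter> cell a l m x) \<le> ennreal \<alpha> * emeasure lebesgue (cell a l m x)"
  shows "emeasure lebesgue F = 0"
proof -
  have [measurable]: "F \<in> sets lebesgue"
    using F by blast
  have le: "measure lebesgue F \<le> \<alpha> * (measure lebesgue F + e)" if "e > 0" for e
  proof -
    obtain U where U: "open U" "F \<subseteq> U" "U - F \<in> lmeasurable" "emeasure lebesgue (U - F) < ennreal e"
      using sets_lebesgue_outer_open[OF \<open>F \<in> sets lebesgue\<close> \<open>e > 0\<close>] by metis
    \<comment> \<open>Stopping starts from points of \<open>F\<close> only, so \<open>sparse\<close>
      applies to every selected cell. They cover \<open>F\<close> because small cells around a point
      of \<open>F\<close> fit into \<open>U\<close>.\<close>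
    define \<K> where "\<K> = first_cells a l (\<lambda>K. K \<subseteq> U) F"
    have sub: "F \<subseteq> \<Union>\<K>" "\<Union>\<K> \<subseteq> U"
      using small_cell[OF l \<open>open U\<close>] U(2) mem_Union_first_cells[OF l, of _ F "\<lambda>K. K \<subseteq> U"]
      unfolding \<K>_def by (blast, auto simp: first_cells_def)
    have \<K>: "countable \<K>" "disjoint \<K>" "\<K> \<subseteq> sets lebesgue"
      unfolding \<K>_def using l
      by (auto intro: countable_first_cells disjoint_first_cells first_cells_sets[THEN subsetD])
    then have [measurable]: "\<Union>\<K> \<in> sets lebesgue"
      by (intro sets.countable_Union) auto
    have "(\<integral>\<^sup>+x\<in>\<Union>\<K>. indicator F x \<partial>lebesgue) \<le> (\<integral>\<^sup>+x\<in>\<Union>\<K>. ennreal \<alpha> \<partial>lebesgue)"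
    proof (rule nn_integral_Union_mono[OF \<K>])
      fix K assume "K \<in> \<K>"
      then obtain m x where K: "K = cell a l m x" "x \<in> F"
        by (auto simp: \<K>_def first_cells_def)
      then show "(\<integral>\<^sup>+x\<in>K. indicator F x \<partial>lebesgue) \<le> (\<integral>\<^sup>+x\<in>K. ennreal \<alpha> \<partial>lebesgue)"
        using sparse[of x m]
        by (simp add: nn_integral_cmult_indicator flip: indicator_inter_arith)
    qed simp_all
    also have "(\<integral>\<^sup>+x\<in>\<Union>\<K>. indicator F x \<partial>lebesgue) = emeasure lebesgue F"
      using sub by (simp add: Int_absorb2 flip: indicator_inter_arith)
    finally have "emeasure lebesgue F \<le> ennreal \<alpha> * emeasure lebesgue (\<Union>\<K>)"
      by (simp add: nn_integral_cmult_indicator)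
    also have "emeasure lebesgue (\<Union>\<K>) \<le> emeasure lebesgue (F \<union> (U - F))"
      using sub U(3) by (intro emeasure_mono sets.Un fmeasurableD[OF F] fmeasurableD) auto
    also have "\<dots> = emeasure lebesgue F + emeasure lebesgue (U - F)"
      using U(3) by (intro plus_emeasure[symmetric]) auto
    also have "\<dots> \<le> emeasure lebesgue F + ennreal e"
      using U(4) by (intro add_left_mono) simp
    finally show ?thesis
      using that \<alpha>
      by (simp add: emeasure_eq_measure2[OF F] mult_left_mono flip: ennreal_plus ennreal_mult)
  qed
  have "measure lebesgue F = 0"
  proof (rule ccontr)
    assume "measure lebesgue F \<noteq> 0"
    then have pos: "(1 - \<alpha>) * measure lebesgue F > 0"
      using \<alpha> by (simp add: zero_less_measure_iff)
    \<comment> \<open>With this \<open>e\<close>, the bound \<open>le\<close> makes the positive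
      number \<open>2 * e\<close> at most \<alpha> times \<open>e\<close>, hence at most
      \<open>e\<close>.\<close>
    define e where "e = (1 - \<alpha>) * measure lebesgue F / 2"
    have e: "e > 0"
      using pos by (simp add: e_def)
    have "(1 - \<alpha>) * measure lebesgue F \<le> \<alpha> * e"
      using le[OF e] by (simp add: algebra_simps)
    also have "\<dots> \<le> e"
      using e \<alpha> by (simp add: mult_left_le_one_le)
    finally show False
      using pos by (simp add: e_def)
  qed
  then show ?thesis
    by (simp add: emeasure_eq_measure2[OF F])
qed

text \<open>The cells are stopped when the density of \<open>E\<close> first exceeds \<alpha>. The
  parent of a stopping cell still has density at most \<alpha> and is \<open>2 ^ CARD('n)\<close>
  times as large, which gives the upper density bound.\<close>

lemma calderon_zygmund_cubes:
  fixes E :: "(real ^ 'n::finite) set"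
  assumes E [measurable]: "E \<in> sets lebesgue" and l: "l > 0" and \<alpha>: "0 \<le> \<alpha>" "\<alpha> < 1"
    and top: "emeasure lebesgue (E \<inter> hcube a l) \<le> ennreal \<alpha> * emeasure lebesgue (hcube a l)"
  obtains \<K> where "countable \<K>" "disjoint \<K>" "\<And>K. K \<in> \<K> \<Longrightarrow> \<exists>b r. r > 0 \<and> K = hcube b r"
    "\<Union>\<K> \<subseteq> hcube a l"
    "\<And>K. K \<in> \<K> \<Longrightarrow> ennreal \<alpha> * emeasure lebesgue K \<le> emeasure lebesgue (E \<inter> K)"
    "\<And>K. K \<in> \<K> \<Longrightarrow> emeasure lebesgue (E \<inter> K) \<le> ennreal (2 ^ CARD('n) * \<alpha>) * emeasure lebesgue K"
    "emeasure lebesgue (E \<inter> hcube a l - \<Union>\<K>) = 0"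
proof
  define P where "P = (\<lambda>K. ennreal \<alpha> * emeasure lebesgue K < emeasure lebesgue (E \<inter> K))"
  let ?\<K> = "first_cells a l P (hcube a l)"
  show countable: "countable ?\<K>"
    by (rule countable_first_cells)
  show "disjoint ?\<K>"
    by (rule disjoint_first_cells[OF l])
  show "\<exists>b r. r > 0 \<and> K = hcube b r" if "K \<in> ?\<K>" for K
    using first_cells_hcube[OF l that] .
  show "\<Union>?\<K> \<subseteq> hcube a l"
  proof
    fix y assume "y \<in> \<Union>?\<K>"
    then obtain m x where "y \<in> cell a l m x" "x \<in> hcube a l"
      unfolding first_cells_def by blast
    then show "y \<in> hcube a l"
      using cell_antimono[OF l, of 0 m a x] cell_0[OF l] by auto
  qed
  show "ennreal \<alpha> * emeasure lebesgue K \<le> emeasure lebesgue (E \<inter> K)" if "K \<in> ?\<K>" for K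
    using that by (auto simp: first_cells_def P_def)
  show "emeasure lebesgue (E \<inter> K) \<le> ennreal (2 ^ CARD('n) * \<alpha>) * emeasure lebesgue K"
    if K: "K \<in> ?\<K>" for K
  proof -
    obtain m x where m: "K = cell a l m x" "P K" "\<forall>j<m. \<not> P (cell a l j x)" "x \<in> hcube a l"
      using K by (auto simp: first_cells_def)
    \<comment> \<open>By \<open>top\<close> the selection does not stop at the initial cube, so
      every stopping cell has a parent inside the range of the selection.\<close>
    have "m \<noteq> 0"
    proof
      assume "m = 0"
      then have "P (hcube a l)"
        using m(1,2) cell_0[OF l m(4)] by simp
      then show False
        using top by (simp add: P_def not_le[symmetric])
    qed
    then obtain k where k: "m = Suc k"
      by (cases m) auto
    have "emeasure lebesgue (E \<inter> K) \<le> emeasure lebesgue (E \<inter> cell a l k x)"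
      using cell_Suc_subset[OF l, of a k x] by (intro emeasure_mono) (auto simp: m(1) k)
    also have "\<dots> \<le> ennreal \<alpha> * emeasure lebesgue (cell a l k x)"
      using m(3) by (auto simp: k P_def not_less)
    also have "\<dots> = ennreal (\<alpha> * (l / 2 ^ k) ^ CARD('n))"
      using l \<alpha> by (simp only: emeasure_cell) (simp add: ennreal_mult)
    also have "\<alpha> * (l / 2 ^ k) ^ CARD('n) = (2 ^ CARD('n) * \<alpha>) * (l / 2 ^ m) ^ CARD('n)"
      by (simp add: k power_divide power_mult_distrib)
    also have "ennreal \<dots> = ennreal (2 ^ CARD('n) * \<alpha>) * emeasure lebesgue K"
      unfolding m(1) emeasure_cell[OF l] using l \<alpha> by (intro ennreal_mult) auto
    finally show ?thesis .
  qed
  have [measurable]: "\<Union>?\<K> \<in> sets lebesgue"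
    using countable first_cells_sets[OF l] by (intro sets.countable_Union) auto
  \<comment> \<open>Around a point of the remainder no cell of any generation satisfies
    \<open>P\<close>, so the remainder is sparse in all its cells.\<close>
  let ?F = "E \<inter> hcube a l - \<Union>?\<K>"
  show "emeasure lebesgue ?F = 0"
  proof (rule null_if_sparse_in_cells[OF _ l \<alpha>])
    show "?F \<in> lmeasurable"
      by (rule fmeasurableI2[OF lmeasurable_hcube[of a l]]) auto
    fix x m assume "x \<in> ?F"
    then have "\<not> P (cell a l m x)"
      using mem_Union_first_cells[OF l, of x "hcube a l" P a m] by blast
    moreover have "emeasure lebesgue (?F \<inter> cell a l m x) \<le> emeasure lebesgue (E \<inter> cell a l m x)"
      by (intro emeasure_mono) auto
    ultimately show "emeasure lebesgue (?F \<inter> cell a l m x) \<le> ennreal \<alpha> * emeasure lebesgue (cell a l m x)"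
      by (auto simp: P_def not_less)
  qed
qed

section \<open>Self-improvement of the truncated mean oscillation\<close>

text \<open>\<open>bound\<close> and \<open>C\<close> range over all cubes because they are applied
  to the stopping cubes, whose position and size are not controlled. The new constant is
  \<open>B + (s + 2 * B) / 2\<close>.\<close>

lemma truncated_oscillation_improve:
  fixes f :: "real ^ 'n::finite \<Rightarrow> real" and C :: "real ^ 'n \<Rightarrow> real \<Rightarrow> real"
  assumes [measurable]: "f \<in> borel_measurable lebesgue" and B: "B \<ge> 0" and s: "s \<ge> 0" and M: "M \<ge> 0"
    and C: "\<And>a l. l > 0 \<Longrightarrow> emeasure lebesgue {x \<in> hcube a l. B < \<bar>f x - C a l\<bar>}
      \<le> ennreal (1 / (8 * 2 ^ CARD('n))) * emeasure lebesgue (hcube a l)"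
    and bound: "\<And>a l. l > 0 \<Longrightarrow> (\<integral>\<^sup>+x\<in>hcube a l. ennreal (min \<bar>f x - C a l\<bar> M) \<partial>lebesgue)
      \<le> ennreal s * emeasure lebesgue (hcube a l)"
    and l: "l > 0"
  shows "(\<integral>\<^sup>+x\<in>hcube a l. ennreal (min \<bar>f x - C a l\<bar> M) \<partial>lebesgue)
      \<le> ennreal (s / 2 + 2 * B) * emeasure lebesgue (hcube a l)"
proof -
  \<comment> \<open>This is twice the density granted by \<open>C\<close>, so the stopping cubes
    fill at most half of the cube. Multiplied by \<open>2 ^ CARD('n)\<close> it is still only 1/4,
    which leaves room for a good point in each stopping cube.\<close>
  define \<alpha> :: real where "\<alpha> = 1 / (4 * 2 ^ CARD('n))"
  have "(1::real) \<le> 2 ^ CARD('n)"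
    by simp
  then have \<alpha>: "0 < \<alpha>" "\<alpha> \<le> 1 / 4" and \<alpha>2: "1 / (8 * 2 ^ CARD('n)) = \<alpha> / 2" "2 ^ CARD('n) * \<alpha> = 1 / 4"
    by (auto simp: \<alpha>_def field_simps)
  define H where "H = hcube a l"
  define h where "h = l ^ CARD('n)"
  have h: "h > 0" "emeasure lebesgue H = ennreal h"
    using emeasure_hcube[OF l, of a] l by (auto simp: H_def h_def)
  have [measurable]: "H \<in> sets lebesgue"
    by (simp add: H_def)
  define E where "E = {x. B < \<bar>f x - C a l\<bar>}"
  have "E = {x \<in> space lebesgue. B < \<bar>f x - C a l\<bar>}"
    by (simp add: E_def)
  also have "\<dots> \<in> sets lebesgue"
    by measurable
  finally have E [measurable]: "E \<in> sets lebesgue" .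
  have "E \<inter> H = {x \<in> hcube a l. B < \<bar>f x - C a l\<bar>}"
    by (auto simp: E_def H_def)
  then have EH: "emeasure lebesgue (E \<inter> H) \<le> ennreal (\<alpha> / 2 * h)"
    using C[OF l, of a] h \<alpha> by (simp add: \<alpha>2 flip: H_def ennreal_mult)
  also have "\<dots> \<le> ennreal (\<alpha> * h)"
    using h \<alpha> by (intro ennreal_leI) simp
  finally have "emeasure lebesgue (E \<inter> hcube a l) \<le> ennreal \<alpha> * emeasure lebesgue (hcube a l)"
    using h \<alpha> by (simp add: ennreal_mult flip: H_def)
  from calderon_zygmund_cubes[OF E l _ _ this] \<alpha>
  obtain \<K> where \<K>: "countable \<K>" "disjoint \<K>" and cube: "\<And>K. K \<in> \<K> \<Longrightarrow> \<exists>b r. r > 0 \<and> K = hcube b r"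
    and sub: "\<Union>\<K> \<subseteq> H"
    and lower: "\<And>K. K \<in> \<K> \<Longrightarrow> ennreal \<alpha> * emeasure lebesgue K \<le> emeasure lebesgue (E \<inter> K)"
    and upper: "\<And>K. K \<in> \<K> \<Longrightarrow> emeasure lebesgue (E \<inter> K) \<le> ennreal (1 / 4) * emeasure lebesgue K"
    and null: "emeasure lebesgue (E \<inter> H - \<Union>\<K>) = 0"
    by (auto simp: \<alpha>2 H_def)
  have \<K>s: "\<K> \<subseteq> sets lebesgue"
    using cube by blast
  then have [measurable]: "\<Union>\<K> \<in> sets lebesgue"
    using \<K>(1) by (intro sets.countable_Union) auto
  define g where "g = (\<lambda>x. ennreal (min \<bar>f x - C a l\<bar> M))"
  have [measurable]: "g \<in> borel_measurable lebesgue"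
    unfolding g_def by measurable

  have small: "emeasure lebesgue (\<Union>\<K>) \<le> ennreal (h / 2)"
  proof -
    have "(\<integral>\<^sup>+x\<in>\<Union>\<K>. ennreal \<alpha> \<partial>lebesgue) \<le> (\<integral>\<^sup>+x\<in>\<Union>\<K>. indicator E x \<partial>lebesgue)"
    proof (rule nn_integral_Union_mono[OF \<K> \<K>s])
      fix K assume K: "K \<in> \<K>"
      then have "K \<in> sets lebesgue"
        using \<K>s by blast
      then show "(\<integral>\<^sup>+x\<in>K. ennreal \<alpha> \<partial>lebesgue) \<le> (\<integral>\<^sup>+x\<in>K. indicator E x \<partial>lebesgue)"
        using lower[OF K]
        by (simp add: nn_integral_cmult_indicator flip: indicator_inter_arith)
    qed simp_all
    also have "\<dots> = emeasure lebesgue (E \<inter> \<Union>\<K>)"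
      by (simp flip: indicator_inter_arith)
    also have "\<dots> \<le> emeasure lebesgue (E \<inter> H)"
      using sub by (intro emeasure_mono) auto
    also note EH
    finally have *: "ennreal \<alpha> * emeasure lebesgue (\<Union>\<K>) \<le> ennreal (\<alpha> / 2 * h)"
      by (simp add: nn_integral_cmult_indicator)
    have "emeasure lebesgue (\<Union>\<K>) \<le> emeasure lebesgue H"
      using sub by (intro emeasure_mono) auto
    \<comment> \<open>Cancelling \<alpha> takes place in the reals, which requires the measure of
      the union to be finite.\<close>
    then obtain u where u: "emeasure lebesgue (\<Union>\<K>) = ennreal u" "u \<ge> 0"
      using h by (cases "emeasure lebesgue (\<Union>\<K>)") (auto simp: top_unique)
    have "\<alpha> * u \<le> \<alpha> * (h / 2)"
      using * u \<alpha> h by (simp flip: ennreal_mult)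
    then show ?thesis
      using \<alpha> h u by (simp add: ennreal_leI)
  qed

  have on_cube: "(\<integral>\<^sup>+x\<in>K. g x \<partial>lebesgue) \<le> (\<integral>\<^sup>+x\<in>K. ennreal (s + 2 * B) \<partial>lebesgue)" if K: "K \<in> \<K>" for K
  proof -
    obtain b r where r: "r > 0" "K = hcube b r"
      using cube[OF K] by blast
    have [measurable]: "K \<in> sets lebesgue"
      using r by simp
    define D where "D = {x \<in> K. B < \<bar>f x - C b r\<bar>}"
    have "D = {x \<in> space lebesgue. x \<in> K \<and> B < \<bar>f x - C b r\<bar>}"
      by (auto simp: D_def)
    also have "\<dots> \<in> sets lebesgue"
      by measurable
    finally have [measurable]: "D \<in> sets lebesgue" .
    define k where "k = r ^ CARD('n)"
    have k: "k > 0" "emeasure lebesgue K = ennreal k"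
      using emeasure_hcube[OF r(1), of b] r by (auto simp: k_def)
    \<comment> \<open>The exceptional sets for the constants of the large cube and of
      \<open>K\<close> fill together at most 3/8 of \<open>K\<close>. At a point \<open>y\<close>
      outside both, \<open>f y\<close> is within \<open>B\<close> of either constant.\<close>
    have "emeasure lebesgue (E \<inter> K \<union> D) \<le> emeasure lebesgue (E \<inter> K) + emeasure lebesgue D"
      by (rule emeasure_subadditive) auto
    also have "\<dots> \<le> ennreal (1 / 4) * emeasure lebesgue K + ennreal (\<alpha> / 2) * emeasure lebesgue K"
      using upper[OF K] C[OF r(1), of b] unfolding \<alpha>2 D_def r(2) by (rule add_mono)
    also have "\<dots> = ennreal ((1 / 4 + \<alpha> / 2) * k)"
      using k \<alpha> by (simp add: distrib_right flip: ennreal_mult ennreal_plus)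
    also have "\<dots> < emeasure lebesgue K"
      unfolding k(2) using k(1) \<alpha> by (intro ennreal_lessI) auto
    finally have "\<not> K \<subseteq> E \<inter> K \<union> D"
      using emeasure_mono[of K "E \<inter> K \<union> D" lebesgue] by (auto simp: not_le[symmetric])
    then obtain y where "y \<in> K" "y \<notin> E" "y \<notin> D"
      by blast
    then have "\<bar>f y - C a l\<bar> \<le> B" "\<bar>f y - C b r\<bar> \<le> B"
      by (auto simp: E_def D_def not_less)
    then have near: "\<bar>C b r - C a l\<bar> \<le> 2 * B"
      by linarith
    have "(\<integral>\<^sup>+x\<in>K. g x \<partial>lebesgue)
        \<le> (\<integral>\<^sup>+x. ennreal (min \<bar>f x - C b r\<bar> M) * indicator K x + ennreal (2 * B) * indicator K x \<partial>lebesgue)"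
    proof (rule nn_integral_mono)
      fix x
      \<comment> \<open>Moving the centre by at most \<open>2 * B\<close> changes the truncated
        value by at most \<open>2 * B\<close>, so the level \<open>M\<close> is preserved.\<close>
      have "min \<bar>f x - C a l\<bar> M \<le> min \<bar>f x - C b r\<bar> M + 2 * B"
        using near B by linarith
      then have "g x \<le> ennreal (min \<bar>f x - C b r\<bar> M) + ennreal (2 * B)"
        unfolding g_def using B M by (simp add: ennreal_leI flip: ennreal_plus)
      then show "g x * indicator K x
          \<le> ennreal (min \<bar>f x - C b r\<bar> M) * indicator K x + ennreal (2 * B) * indicator K x"
        by (auto simp: indicator_def)
    qed
    also have "\<dots> = (\<integral>\<^sup>+x\<in>K. ennreal (min \<bar>f x - C b r\<bar> M) \<partial>lebesgue) + ennreal (2 * B) * emeasure lebesgue K"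
      by (subst nn_integral_add) (auto simp: nn_integral_cmult_indicator)
    also have "\<dots> \<le> ennreal s * emeasure lebesgue K + ennreal (2 * B) * emeasure lebesgue K"
      using bound[OF r(1), of b] unfolding r(2) by (rule add_right_mono)
    also have "\<dots> = (\<integral>\<^sup>+x\<in>K. ennreal (s + 2 * B) \<partial>lebesgue)"
      using s B by (subst nn_integral_cmult_indicator) (simp_all add: distrib_right)
    finally show ?thesis .
  qed

  \<comment> \<open>Outside this null set, a point of \<open>H\<close> is either in a stopping cube
    or has \<open>g\<close> at most \<open>B\<close>. The value \<open>B\<close> is charged on all
    of \<open>H\<close>, stopping cubes included.\<close>
  have "AE x in lebesgue. x \<notin> E \<inter> H - \<Union>\<K>"
    using null by (intro AE_not_in) (auto simp: null_sets_def)
  then have "(\<integral>\<^sup>+x\<in>H. g x \<partial>lebesgue)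
      \<le> (\<integral>\<^sup>+x. ennreal B * indicator H x + g x * indicator (\<Union>\<K>) x \<partial>lebesgue)"
  proof (intro nn_integral_mono_AE, eventually_elim)
    fix x assume "x \<notin> E \<inter> H - \<Union>\<K>"
    then consider "x \<notin> H" | "x \<in> \<Union>\<K>" | "x \<notin> E" "x \<in> H" by blast
    then show "g x * indicator H x \<le> ennreal B * indicator H x + g x * indicator (\<Union>\<K>) x"
    proof cases
      case 1 then show ?thesis by simp
    next
      case 2 then show ?thesis using sub by (auto simp: add_increasing)
    next
      case 3
      then have "g x \<le> ennreal B"
        unfolding g_def E_def by (intro ennreal_leI) auto
      with 3 show ?thesis by (simp add: add_increasing2)
    qed
  qed
  also have "\<dots> = ennreal B * ennreal h + (\<integral>\<^sup>+x\<in>\<Union>\<K>. g x \<partial>lebesgue)"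
    by (subst nn_integral_add) (auto simp: nn_integral_cmult_indicator h)
  also have "\<dots> \<le> ennreal B * ennreal h + (\<integral>\<^sup>+x\<in>\<Union>\<K>. ennreal (s + 2 * B) \<partial>lebesgue)"
    by (intro add_left_mono nn_integral_Union_mono[OF \<K> \<K>s] on_cube) simp_all
  also have "\<dots> \<le> ennreal B * ennreal h + ennreal (s + 2 * B) * ennreal (h / 2)"
    using small by (simp add: nn_integral_cmult_indicator mult_left_mono)
  also have "\<dots> = ennreal ((s / 2 + 2 * B) * h)"
    using s B h by (simp add: algebra_simps flip: ennreal_mult ennreal_plus)
  also have "\<dots> = ennreal (s / 2 + 2 * B) * emeasure lebesgue H"
    using s B h by (simp add: ennreal_mult)
  finally show ?thesis
    by (simp add: g_def H_def)
qed

text \<open>Truncation supplies the finite initial bound for the iteration, since \<open>f\<close>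
  is not yet known to be integrable. The limiting bound does not depend on the level, so Fatou's
  lemma removes the truncation.\<close>

lemma mean_oscillation_le_hcube:
  fixes f :: "real ^ 'n::finite \<Rightarrow> real" and C :: "real ^ 'n \<Rightarrow> real \<Rightarrow> real"
  assumes f [measurable]: "f \<in> borel_measurable lebesgue" and B: "B \<ge> 0"
    and C: "\<And>a l. l > 0 \<Longrightarrow> emeasure lebesgue {x \<in> hcube a l. B < \<bar>f x - C a l\<bar>}
      \<le> ennreal (1 / (8 * 2 ^ CARD('n))) * emeasure lebesgue (hcube a l)"
    and l: "l > 0"
  shows "(\<integral>\<^sup>+x\<in>hcube a l. ennreal \<bar>f x - C a l\<bar> \<partial>lebesgue)
      \<le> ennreal (4 * B) * emeasure lebesgue (hcube a l)"
proof -
  have trunc: "(\<integral>\<^sup>+x\<in>hcube a l. ennreal (min \<bar>f x - C a l\<bar> M) \<partial>lebesgue)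
      \<le> ennreal (4 * B) * emeasure lebesgue (hcube a l)" if M: "M \<ge> 0" for M
  proof -
    \<comment> \<open>\<open>4 * B\<close> is the fixed point of the map sending \<open>s\<close> to
      \<open>s / 2 + 2 * B\<close>, and the excess over it halves in each round. The induction runs
      over all cubes at once, as each round needs the previous bound on every cube.\<close>
    have iter: "(\<integral>\<^sup>+x\<in>hcube a l. ennreal (min \<bar>f x - C a l\<bar> M) \<partial>lebesgue)
        \<le> ennreal (4 * B + M / 2 ^ k) * emeasure lebesgue (hcube a l)" if "l > 0" for k a l
      using that
    proof (induction k arbitrary: a l)
      case 0
      have "(\<integral>\<^sup>+x\<in>hcube a l. ennreal (min \<bar>f x - C a l\<bar> M) \<partial>lebesgue)
          \<le> (\<integral>\<^sup>+x\<in>hcube a l. ennreal (4 * B + M / 2 ^ 0) \<partial>lebesgue)"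
        using B by (intro nn_integral_mono mult_right_mono ennreal_leI) auto
      then show ?case
        by (simp add: nn_integral_cmult_indicator)
    next
      case (Suc k)
      have "(\<integral>\<^sup>+x\<in>hcube a l. ennreal (min \<bar>f x - C a l\<bar> M) \<partial>lebesgue)
          \<le> ennreal ((4 * B + M / 2 ^ k) / 2 + 2 * B) * emeasure lebesgue (hcube a l)"
        by (rule truncated_oscillation_improve[OF f B _ M C Suc.IH Suc.prems]) (use B M in auto)
      also have "(4 * B + M / 2 ^ k) / 2 + 2 * B = 4 * B + M / 2 ^ Suc k"
        by (simp add: field_simps)
      finally show ?case .
    qed
    have "(\<lambda>k. 4 * B + M * (1 / 2) ^ k) \<longlonglongrightarrow> 4 * B + M * 0"
      by (intro tendsto_intros LIMSEQ_realpow_zero) auto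
    then have "(\<lambda>k. ennreal (4 * B + M / 2 ^ k)) \<longlonglongrightarrow> ennreal (4 * B)"
      by (intro tendsto_ennrealI) (simp add: power_divide)
    then have "(\<lambda>k. ennreal (4 * B + M / 2 ^ k) * emeasure lebesgue (hcube a l))
        \<longlonglongrightarrow> ennreal (4 * B) * emeasure lebesgue (hcube a l)"
      using l by (intro tendsto_mult_ennreal tendsto_const) (auto simp: emeasure_hcube)
    then show ?thesis
      by (rule LIMSEQ_le_const) (use iter[OF l] in blast)
  qed
  have "(\<integral>\<^sup>+x\<in>hcube a l. ennreal \<bar>f x - C a l\<bar> \<partial>lebesgue)
      = (\<integral>\<^sup>+x. liminf (\<lambda>k. ennreal (min \<bar>f x - C a l\<bar> (real k)) * indicator (hcube a l) x) \<partial>lebesgue)"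
  proof (intro nn_integral_cong)
    fix x
    obtain N :: nat where N: "\<bar>f x - C a l\<bar> \<le> real N"
      using real_arch_simple by blast
    have "eventually (\<lambda>k. ennreal (min \<bar>f x - C a l\<bar> (real k)) * indicator (hcube a l) x
        = ennreal \<bar>f x - C a l\<bar> * indicator (hcube a l) x) sequentially"
      using eventually_ge_at_top[of N] by eventually_elim (use N in \<open>simp add: min_absorb1\<close>)
    then have "(\<lambda>k. ennreal (min \<bar>f x - C a l\<bar> (real k)) * indicator (hcube a l) x)
        \<longlonglongrightarrow> ennreal \<bar>f x - C a l\<bar> * indicator (hcube a l) x"
      by (rule tendsto_eventually)
    then show "ennreal \<bar>f x - C a l\<bar> * indicator (hcube a l) x
        = liminf (\<lambda>k. ennreal (min \<bar>f x - C a l\<bar> (real k)) * indicator (hcube a l) x)"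
      by (simp add: lim_imp_Liminf)
  qed
  \<comment> \<open>Fatou's lemma along the truncation levels \<open>real k\<close>.\<close>
  also have "\<dots> \<le> liminf (\<lambda>k. \<integral>\<^sup>+x\<in>hcube a l. ennreal (min \<bar>f x - C a l\<bar> (real k)) \<partial>lebesgue)"
    by (rule nn_integral_liminf) measurable
  also have "\<dots> \<le> limsup (\<lambda>k. \<integral>\<^sup>+x\<in>hcube a l. ennreal (min \<bar>f x - C a l\<bar> (real k)) \<partial>lebesgue)"
    by (intro Liminf_le_Limsup) simp
  also have "\<dots> \<le> ennreal (4 * B) * emeasure lebesgue (hcube a l)"
    by (intro Limsup_bounded always_eventually allI trunc) simp
  finally show ?thesis .
qed

section \<open>From oscillation about arbitrary constants to the BMO norm\<close>

lemma set_integrable_of_oscillation: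
  fixes f :: "'a \<Rightarrow> real"
  assumes [measurable]: "f \<in> borel_measurable M" "Q \<in> sets M" and Q: "emeasure M Q < \<infinity>"
    and fin: "(\<integral>\<^sup>+x\<in>Q. ennreal \<bar>f x - c\<bar> \<partial>M) < \<infinity>"
  shows "set_integrable M Q (\<lambda>x. f x - c)" "set_integrable M Q f"
proof -
  have const: "set_integrable M Q (\<lambda>_. c)"
    using Q by (simp add: set_integrable_def)
  show int: "set_integrable M Q (\<lambda>x. f x - c)"
    unfolding set_integrable_def
  proof (rule integrableI_bounded)
    have "(\<integral>\<^sup>+x. ennreal (norm (indicat_real Q x *\<^sub>R (f x - c))) \<partial>M) = (\<integral>\<^sup>+x\<in>Q. ennreal \<bar>f x - c\<bar> \<partial>M)"
      by (intro nn_integral_cong) (simp add: indicator_def)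
    then show "(\<integral>\<^sup>+x. ennreal (norm (indicat_real Q x *\<^sub>R (f x - c))) \<partial>M) < \<infinity>"
      using fin by simp
  qed measurable
  show "set_integrable M Q f"
    using set_integral_add(1)[OF int const] by simp
qed

text \<open>The mean of \<open>f\<close> is itself within \<open>b\<close> of \<open>c\<close>, so
  replacing \<open>c\<close> by the mean costs at most a factor 2.\<close>

lemma average_oscillation_le:
  fixes f :: "real ^ 'n::finite \<Rightarrow> real"
  assumes f [measurable]: "f \<in> borel_measurable lebesgue" and Q: "Q \<in> lmeasurable" "measure lebesgue Q > 0"
    and b: "b \<ge> 0" and le: "(\<integral>\<^sup>+x\<in>Q. ennreal \<bar>f x - c\<bar> \<partial>lebesgue) \<le> ennreal b * emeasure lebesgue Q"
  shows "average Q (\<lambda>x. \<bar>f x - average Q f\<bar>) \<le> 2 * b"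
proof -
  have Qs [measurable]: "Q \<in> sets lebesgue" and Qfin: "emeasure lebesgue Q < \<infinity>"
    using Q by (auto simp: fmeasurable_def)
  define q where "q = measure lebesgue Q"
  have q: "q > 0" "emeasure lebesgue Q = ennreal q"
    using Q by (auto simp: q_def emeasure_eq_measure2)
  have fin: "(\<integral>\<^sup>+x\<in>Q. ennreal \<bar>f x - c\<bar> \<partial>lebesgue) < \<infinity>"
    using le q by (auto intro: le_less_trans simp: ennreal_mult_less_top)
  note int = set_integrable_of_oscillation[OF f Qs Qfin fin]
  have const: "set_integrable lebesgue Q (\<lambda>_. d)" for d :: real
    using Qfin by (simp add: set_integrable_def)
  have const_eq: "(LINT x:Q|lebesgue. d) = d * q" for d :: real
    using Q by (simp add: q_def set_lebesgue_integral_def)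
  have abs_int: "set_integrable lebesgue Q (\<lambda>x. \<bar>f x - d\<bar>)" for d
    using set_integrable_abs[OF set_integral_diff(1)[OF int(2) const]] by simp
  have osc: "(LINT x:Q|lebesgue. \<bar>f x - c\<bar>) \<le> b * q"
  proof -
    have "ennreal (LINT x:Q|lebesgue. \<bar>f x - c\<bar>) = (\<integral>\<^sup>+x. ennreal (indicat_real Q x *\<^sub>R \<bar>f x - c\<bar>) \<partial>lebesgue)"
      using abs_int[of c] unfolding set_lebesgue_integral_def set_integrable_def
      by (intro nn_integral_eq_integral[symmetric]) auto
    also have "\<dots> = (\<integral>\<^sup>+x\<in>Q. ennreal \<bar>f x - c\<bar> \<partial>lebesgue)"
      by (intro nn_integral_cong) (simp add: indicator_def)
    also have "\<dots> \<le> ennreal (b * q)"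
      using le b q by (simp add: ennreal_mult)
    finally show ?thesis
      using b q by simp
  qed
  have "(average Q f - c) * q = (LINT x:Q|lebesgue. f x - c)"
    using q by (subst set_integral_diff(2)[OF int(2) const])
      (simp add: average_def const_eq left_diff_distrib flip: q_def)
  then have "\<bar>average Q f - c\<bar> * q = \<bar>LINT x:Q|lebesgue. f x - c\<bar>"
    using q by (metis abs_mult abs_of_pos)
  also have "\<dots> \<le> (LINT x:Q|lebesgue. \<bar>f x - c\<bar>)"
    using set_integral_norm_bound[OF int(1)] by simp
  also note osc
  finally have mean: "\<bar>c - average Q f\<bar> * q \<le> b * q"
    by (simp add: abs_minus_commute)
  have "(LINT x:Q|lebesgue. \<bar>f x - average Q f\<bar>)
      \<le> (LINT x:Q|lebesgue. \<bar>f x - c\<bar> + \<bar>c - average Q f\<bar>)"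
    by (intro set_integral_mono abs_int set_integral_add(1) const) auto
  also have "\<dots> = (LINT x:Q|lebesgue. \<bar>f x - c\<bar>) + \<bar>c - average Q f\<bar> * q"
    by (subst set_integral_add(2)[OF abs_int const]) (simp add: const_eq)
  also have "\<dots> \<le> 2 * b * q"
    using osc mean by simp
  finally show ?thesis
    using q unfolding average_def by (simp add: pos_divide_le_eq flip: q_def)
qed

text \<open>Since \<open>bmo_norm\<close> is infinite without local integrability, this has to be
  derived from \<open>osc\<close>: a compact set lies in some cube, and there \<open>f\<close>
  differs by a constant from an integrable function.\<close>

lemma bmo_norm_le_of_oscillation:
  fixes f :: "real ^ 'n::finite \<Rightarrow> real"
  assumes f [measurable]: "f \<in> borel_measurable lebesgue" and b: "b \<ge> 0"
    and osc: "\<And>Q. Q \<in> cubes \<Longrightarrow>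
      \<exists>c. (\<integral>\<^sup>+x\<in>Q. ennreal \<bar>f x - c\<bar> \<partial>lebesgue) \<le> ennreal b * emeasure lebesgue Q"
  shows "bmo_norm f \<le> ennreal (2 * b)"
proof -
  have cube: "Q \<in> lmeasurable \<and> measure lebesgue Q > 0" if cubes: "Q \<in> cubes" for Q :: "(real ^ 'n) set"
  proof -
    obtain a l where Q: "Q = cbox a (\<chi> i. a $ i + l)" "l > 0"
      using cubes unfolding cubes_def by blast
    then have "measure lebesgue Q = l ^ CARD('n)"
      using emeasure_cube[of l a] by (simp add: measure_def)
    with Q show ?thesis
      by simp
  qed
  have "locally_integrable f"
    unfolding locally_integrable_def
  proof (intro allI impI)
    fix K :: "(real ^ 'n) set"
    assume K: "compact K"
    then obtain r where r: "r > 0" "\<And>x. x \<in> K \<Longrightarrow> norm x \<le> r"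
      using compact_imp_bounded bounded_pos by metis
    define a :: "real ^ 'n" where "a = (\<chi> i. - r)"
    define Q where "Q = cbox a (\<chi> i. a $ i + 2 * r)"
    have Q: "Q \<in> cubes"
      unfolding Q_def cubes_def using r by fastforce
    have "K \<subseteq> Q"
    proof
      fix x assume "x \<in> K"
      then have "\<bar>x $ i\<bar> \<le> r" for i
        using component_le_norm_cart[of x i] r(2)[of x] by linarith
      then show "x \<in> Q"
        by (simp add: Q_def a_def mem_box_cart abs_le_iff) (smt (verit))
    qed
    moreover have "set_integrable lebesgue Q f"
    proof -
      obtain c where c: "(\<integral>\<^sup>+x\<in>Q. ennreal \<bar>f x - c\<bar> \<partial>lebesgue) \<le> ennreal b * emeasure lebesgue Q"
        using osc[OF Q] by blast
      have "Q \<in> sets lebesgue" "emeasure lebesgue Q < \<infinity>"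
        using cube[OF Q] by (auto simp: fmeasurable_def)
      with c show ?thesis
        by (intro set_integrable_of_oscillation(2)[OF f, of Q c])
          (auto intro: le_less_trans simp: ennreal_mult_less_top)
    qed
    ultimately show "set_integrable lebesgue K f"
      using K by (intro set_integrable_subset[of lebesgue Q f K]) (auto intro: lmeasurable_compact fmeasurableD)
  qed
  moreover have "average Q (\<lambda>x. \<bar>f x - average Q f\<bar>) \<le> 2 * b" if "Q \<in> cubes" for Q
    using osc[OF that] cube[OF that] average_oscillation_le[OF f _ _ b] by blast
  ultimately show ?thesis
    by (auto simp: bmo_norm_def intro!: SUP_least ennreal_leI)
qed

section \<open>Chebyshev's inequality for the \<psi>-norm and the final constant\<close>

lemma sparse_of_psi_norm:
  fixes f :: "real ^ 'n::finite \<Rightarrow> real"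
  assumes [measurable]: "f \<in> borel_measurable lebesgue" and N: "N > 0" and T: "T \<ge> 0"
    and large: "\<And>t. t \<ge> T \<Longrightarrow> \<psi> t \<ge> N"
    and less: "bmo_psi_norm \<psi> f < ennreal A" and l: "l > 0"
  shows "\<exists>c. emeasure lebesgue {x \<in> hcube a l. T * A < \<bar>f x - c\<bar>}
    \<le> ennreal (1 / N) * emeasure lebesgue (hcube a l)"
proof -
  define Q where "Q = cbox a (\<chi> i. a $ i + l)"
  define q where "q = l ^ CARD('n)"
  have q: "q > 0" "emeasure lebesgue Q = ennreal q" "emeasure lebesgue (hcube a l) = ennreal q"
    using l by (auto simp: q_def Q_def emeasure_cube emeasure_hcube)
  have "Q \<in> cubes"
    using l by (auto simp: Q_def cubes_def)
  then have "(INF c::real. psi_norm \<psi> Q (\<lambda>x. f x - c)) < ennreal A"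
    using less unfolding bmo_psi_norm_def by (meson SUP_upper le_less_trans)
  \<comment> \<open>The strict bound passes through both infima and yields a constant
    \<open>c\<close> with an admissible scale \<open>r\<close> below \<open>A\<close>, whether or
    not the infima are attained.\<close>
  then obtain c r where r: "r > 0" "ennreal r < ennreal A"
    and le: "(\<integral>\<^sup>+x\<in>Q. ennreal (\<psi> (\<bar>f x - c\<bar> / r)) \<partial>lebesgue) / emeasure lebesgue Q \<le> 1"
    by (auto simp: INF_less_iff psi_norm_def Inf_less_iff)
  have rA: "r < A"
    using r by (simp add: ennreal_less_iff)
  define G where "G = {x \<in> hcube a l. T * A < \<bar>f x - c\<bar>}"
  have "G = {x \<in> space lebesgue. x \<in> hcube a l \<and> T * A < \<bar>f x - c\<bar>}"
    by (simp add: G_def)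
  also have "\<dots> \<in> sets lebesgue"
    by measurable
  finally have [measurable]: "G \<in> sets lebesgue" .
  have "ennreal N * emeasure lebesgue G = (\<integral>\<^sup>+x. ennreal N * indicator G x \<partial>lebesgue)"
    by (simp add: nn_integral_cmult_indicator)
  \<comment> \<open>The left integrand is a measurable step function below the right one, so the
    estimate holds even where the right side is a lower integral.\<close>
  also have "\<dots> \<le> (\<integral>\<^sup>+x\<in>Q. ennreal (\<psi> (\<bar>f x - c\<bar> / r)) \<partial>lebesgue)"
  proof (rule nn_integral_mono)
    fix x
    show "ennreal N * indicator G x \<le> ennreal (\<psi> (\<bar>f x - c\<bar> / r)) * indicator Q x"
    proof (cases "x \<in> G")
      case True
      then have "x \<in> Q"
        by (auto simp: G_def Q_def hcube_def mem_box_cart intro: less_imp_le)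
      have "T * r \<le> T * A"
        using rA T by (intro mult_left_mono) auto
      then have "T * r \<le> \<bar>f x - c\<bar>"
        using True by (simp add: G_def)
      then have "N \<le> \<psi> (\<bar>f x - c\<bar> / r)"
        using r by (intro large) (simp add: pos_le_divide_eq)
      then show ?thesis
        using True \<open>x \<in> Q\<close> by (simp add: ennreal_leI)
    qed simp
  qed
  also have "\<dots> = (\<integral>\<^sup>+x\<in>Q. ennreal (\<psi> (\<bar>f x - c\<bar> / r)) \<partial>lebesgue) / emeasure lebesgue Q * emeasure lebesgue Q"
    using q by (simp add: ennreal_divide_times ennreal_mult_divide_eq mult_divide_eq_ennreal)
  also have "\<dots> \<le> ennreal q"
    using mult_right_mono[OF le, of "emeasure lebesgue Q"] q by simp
  finally have "ennreal (1 / N) * (ennreal N * emeasure lebesgue G) \<le> ennreal (1 / N) * ennreal q"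
    by (rule mult_left_mono) simp
  moreover have "ennreal (1 / N) * (ennreal N * emeasure lebesgue G) = emeasure lebesgue G"
    using N by (simp add: mult.assoc[symmetric] flip: ennreal_mult)
  ultimately show ?thesis
    using q unfolding G_def by auto
qed

theorem theorem1p3:
  fixes \<psi> :: "real \<Rightarrow> real"
  assumes "\<psi> \<in> {0..} \<rightarrow> {0..}"
    and "\<psi> \<in> borel_measurable (lebesgue_on {0..})"
    and "\<psi> 0 = 0"
    and "filterlim \<psi> at_top at_top"
  shows "\<exists>c::real. c > 0 \<and>
    (\<forall>f :: real ^ 'n::finite \<Rightarrow> real. f \<in> borel_measurable lebesgue \<longrightarrow>
       bmo_norm f \<le> ennreal c * bmo_psi_norm \<psi> f)"
proof -
  \<comment> \<open>Chebyshev's bound \<open>1 / N\<close> is then exactly the density required by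
    the oscillation estimate.\<close>
  define N :: real where "N = 8 * 2 ^ CARD('n)"
  have N: "N > 0"
    by (simp add: N_def)
  obtain T0 where T0: "\<And>t. t \<ge> T0 \<Longrightarrow> \<psi> t \<ge> N"
    using assms(4) by (auto simp: filterlim_at_top eventually_at_top_linorder)
  \<comment> \<open>The maximum with 1 makes \<open>T\<close> positive, and with it the final
    constant \<open>8 * T\<close>.\<close>
  define T where "T = max T0 1"
  have T: "T > 0" "\<And>t. t \<ge> T \<Longrightarrow> \<psi> t \<ge> N"
    using T0 by (auto simp: T_def)
  have main: "bmo_norm f \<le> ennreal (8 * T * A)"
    if f: "f \<in> borel_measurable lebesgue" and A: "bmo_psi_norm \<psi> f < ennreal A"
    for f :: "real ^ 'n \<Rightarrow> real" and A
  proof -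
    \<comment> \<open>\<open>ennreal\<close> sends negative reals to 0, so a value strictly below
      \<open>ennreal A\<close> forces \<open>A\<close> to be positive.\<close>
    have "A > 0"
      using A by (metis ennreal_less_zero_iff le_less_trans zero_le)
    have "\<exists>c. emeasure lebesgue {x \<in> hcube a l. T * A < \<bar>f x - c\<bar>}
        \<le> ennreal (1 / N) * emeasure lebesgue (hcube a l)" if "l > 0" for a l
      using sparse_of_psi_norm[OF f N _ T(2) A that] T(1) by simp
    then have "\<forall>a l. \<exists>c. l > 0 \<longrightarrow> emeasure lebesgue {x \<in> hcube a l. T * A < \<bar>f x - c\<bar>}
        \<le> ennreal (1 / N) * emeasure lebesgue (hcube a l)"
      by blast
    then obtain C where C: "\<And>a l. l > 0 \<Longrightarrow> emeasure lebesgue {x \<in> hcube a l. T * A < \<bar>f x - C a l\<bar>}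
        \<le> ennreal (1 / N) * emeasure lebesgue (hcube a l)"
      unfolding choice_iff by blast
    \<comment> \<open>The factor 4 comes from the iteration and the factor 2 from passing to the
      mean.\<close>
    have "bmo_norm f \<le> ennreal (2 * (4 * (T * A)))"
    proof (rule bmo_norm_le_of_oscillation[OF f])
      fix Q :: "(real ^ 'n) set"
      assume "Q \<in> cubes"
      then obtain a l where Q: "Q = cbox a (\<chi> i. a $ i + l)" "l > 0"
        by (auto simp: cubes_def)
      have "(\<integral>\<^sup>+x\<in>Q. ennreal \<bar>f x - C a l\<bar> \<partial>lebesgue) = (\<integral>\<^sup>+x\<in>hcube a l. ennreal \<bar>f x - C a l\<bar> \<partial>lebesgue)"
        using AE_hcube_cbox[of a l] unfolding Q(1)
        by (intro nn_integral_cong_AE, eventually_elim) (simp add: indicator_def)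
      also have "\<dots> \<le> ennreal (4 * (T * A)) * emeasure lebesgue (hcube a l)"
        by (rule mean_oscillation_le_hcube[OF f _ _ Q(2)]) (use C T(1) \<open>A > 0\<close> in \<open>auto simp: N_def\<close>)
      also have "emeasure lebesgue (hcube a l) = emeasure lebesgue Q"
        unfolding Q(1) by (simp only: emeasure_hcube[OF Q(2)] emeasure_cube[OF Q(2)])
      finally show "\<exists>c. (\<integral>\<^sup>+x\<in>Q. ennreal \<bar>f x - c\<bar> \<partial>lebesgue) \<le> ennreal (4 * (T * A)) * emeasure lebesgue Q"
        by blast
    qed (use T(1) \<open>A > 0\<close> in simp)
    then show ?thesis
      by (simp add: mult.assoc)
  qed
  have "bmo_norm f \<le> ennreal (8 * T) * bmo_psi_norm \<psi> f"
    if f: "f \<in> borel_measurable lebesgue" for f :: "real ^ 'n \<Rightarrow> real"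
  proof (cases "bmo_psi_norm \<psi> f")
    case (real v)
    show ?thesis
    proof (rule ennreal_le_epsilon)
      fix e :: real assume e: "e > 0"
      \<comment> \<open>\<open>main\<close> requires a strict bound on the norm \<open>v\<close>, so
        \<open>A\<close> exceeds it by an amount that contributes exactly \<open>e\<close> after
        multiplication by \<open>8 * T\<close>. This also covers \<open>v = 0\<close>.\<close>
      have "bmo_norm f \<le> ennreal (8 * T * (v + e / (8 * T)))"
        using real e T(1) by (intro main f) (simp add: ennreal_less_iff)
      also have "\<dots> = ennreal (8 * T) * bmo_psi_norm \<psi> f + ennreal e"
        using real e T(1) by (simp add: distrib_left flip: ennreal_mult ennreal_plus)
      finally show "bmo_norm f \<le> ennreal (8 * T) * bmo_psi_norm \<psi> f + ennreal e" .
    qed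
  next
    case top
    then show ?thesis
      using T(1) by (simp add: ennreal_mult_top)
  qed
  then show ?thesis
    using T(1) by (intro exI[of _ "8 * T"]) simp
qed

end
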